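(* Consider any adaptive adversary (injection strategy together with an answering entity $\mathrm{ADV}$) playing against the algorithm MIX-R in the problem of buffer management with bounded delay. Let $N\ge 1$ be the maximum, over all steps (of all plays of the game that can occur), of the number of packets that MIX-R assigns positive transmission probability in a step. Then $$\mathbb{E}[\mathcal{G}_{\text{MIX-R}}(I)]\ \ge\ \Bigl(1-\bigl(1-\tfrac1N\bigr)^N\Bigr)\cdot \mathbb{E}[\mathcal{G}_{\mathrm{ADV}}(I)],$$ where $I$ is the (random) instance created by the adversary. That is, MIX-R is $1/\bigl(1-(1-\frac1N)^N\bigr)$-competitive against an adaptive adversary.
   Context: **Problem (buffer management with bounded delay).** Time is divided into unit steps; step $t$ corresponds to the interval $(t,t+1)$. A packet is $(w,d)$ with weight $w>0$ and relative deadline $d$ (a positive integer at injection), the number of steps after which it expires; distinct packets may have equal weight and deadline. Buffers are initially empty. Before each step any finite set of packets may be injected, into both the algorithm's and $\mathrm{ADV}$'s buffers. In step $t$ the algorithm and $\mathrm{ADV}$ independently each choose and transmit at most one packet from their own buffer; a transmitted packet is removed from the buffer of the party that transmitted it. At time $t+1$ the relative deadlines of all remaining packets are decremented by $1$, packets whose relative deadline reaches $0$ expire and are removed from both buffers, and then the adversary injects any finite set of packets and step $t+1$ begins. A packet is pending for a party if it has been released and has neither expired nor been transmitted by that party. The gain $\mathcal{G}_X(I)$ of $X$ on instance $I$ (the sequence of injected packets) is the total weight of packets transmitted by $X$. **Adaptive(-online) adversary.** The packets injected at a given time may depend on the algorithm's (random) behavior up to that time. The adversary also provides an answering entity $\mathrm{ADV}$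 that creates its own solution in parallel with the algorithm and cannot change it afterwards: its transmission in step $t$ is chosen without knowledge of the algorithm's random choice in step $t$ or later. $\mathrm{ADV}$ is deterministic (without loss of generality), but since the algorithm is randomized, so is $I$. An algorithm $\mathrm{ALG}$ is $R$-competitive against an adaptive adversary if for any adaptively created instance $I$ and any answering entity $\mathrm{ADV}$, $\mathbb{E}[\mathcal{G}_{\mathrm{ALG}}(I)]\ge \frac1R\,\mathbb{E}[\mathcal{G}_{\mathrm{ADV}}(I)]$ (no additive constant). **Dominance.** A pending packet $a=(w_a,d_a)$ is dominated by a pending packet $b=(w_b,d_b)$ if $w_a\le w_b$ and $d_a\ge d_b$; it is strictly dominated by $b$ if moreover one of these inequalities is strict. A packet is (strictly) dominated if some pending packet (strictly) dominates it. **Algorithm MIX-R (one step).** If there are no pending packets, do nothing. Otherwise set $m\leftarrow 0$, $n\leftarrow 0$, $r\leftarrow 1$, $H_0\leftarrow$ the set of packets pending for the algorithm, and $h_0=(w_0,d_0)\leftarrow$ a heaviest packet of $H_0$. While $H_m\neq\emptyset$, do: 1. $m\leftarrow m+1$; 2. $h_m=(w_m,d_m)\leftarrow$ a heaviest not strictly dominated packet from $H_{m-1}$; 3. $p_{m-1}\leftarrow\min\{1-\frac{w_m}{w_{m-1}},\,r\}$; 4. $r\leftarrow r-p_{m-1}$; 5. if $r>0$ then $n\leftarrow n+1$; 6. $H_m\leftarrow\{x\in H_{m-1} : x\text{ is not dominated by }h_m\}$. After the loop set $p_m\leftarrow r$. Transmit a packet chosen (with fresh randomness) from $h_1,\dots,h_n$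 with probability distribution $p_1,\dots,p_n$. (Always $p_0=0$.) The number of packets assigned positive probability in the step is the final value of $n$. *)

theory Defs
  imports "HOL-Probability.Probability"
begin

section \<open>Packets and dominance\<close>

text \<open>
  A packet is a pair of its weight and its current relative deadline.  Distinct packets may agree
  in both components, so buffers are multisets of such pairs: packets with equal weight and equal
  deadline are interchangeable.
\<close>

type_synonym packet = "real \<times> nat"

abbreviation weight :: "packet \<Rightarrow> real" where "weight \<equiv> fst"
abbreviation deadline :: "packet \<Rightarrow> nat" where "deadline \<equiv> snd"

definition dominated_by :: "packet \<Rightarrow> packet \<Rightarrow> bool" where
  "dominated_by a b \<longleftrightarrow> weight a \<le> weight b \<and> deadline a \<ge> deadline b"

definition strictly_dominated_by :: "packet \<Rightarrow> packet \<Rightarrow> bool" where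
  "strictly_dominated_by a b \<longleftrightarrow>
     dominated_by a b \<and> (weight a < weight b \<or> deadline a > deadline b)"


section \<open>One step of MIX-R\<close>

text \<open>
  Throughout, \<open>P\<close> is the set of packets pending for the algorithm at the beginning of the step.
  The values of the program variables of the loop are indexed by the number \<open>m\<close> of iterations.
\<close>

definition heaviest_nondominated :: "packet set \<Rightarrow> packet set \<Rightarrow> packet" where
  "heaviest_nondominated P H = arg_max_on weight {x \<in> H. \<not> (\<exists>y\<in>P. strictly_dominated_by x y)}"

primrec mixr_H :: "packet set \<Rightarrow> nat \<Rightarrow> packet set" where
  "mixr_H P 0 = P"
| "mixr_H P (Suc m) =
     {x \<in> mixr_H P m. \<not> dominated_by x (heaviest_nondominated P (mixr_H P m))}"

text \<open>
  The choice made by \<^const>\<open>arg_max_on\<close> is immaterial: only the weight of \<open>h\<^sub>0\<close> is ever used, and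
  two packets of equal weight neither of which strictly dominates the other are equal as pairs.
\<close>

primrec mixr_h :: "packet set \<Rightarrow> nat \<Rightarrow> packet" where
  "mixr_h P 0 = arg_max_on weight P"
| "mixr_h P (Suc m) = heaviest_nondominated P (mixr_H P m)"

primrec mixr_r :: "packet set \<Rightarrow> nat \<Rightarrow> real" where
  "mixr_r P 0 = 1"
| "mixr_r P (Suc m) =
     mixr_r P m - min (1 - weight (mixr_h P (Suc m)) / weight (mixr_h P m)) (mixr_r P m)"

text \<open>The value of \<open>m\<close> when the loop terminates:\<close>

definition mixr_last :: "packet set \<Rightarrow> nat" where
  "mixr_last P = (LEAST m. mixr_H P m = {})"

definition mixr_p :: "packet set \<Rightarrow> nat \<Rightarrow> real" where
  "mixr_p P m =
     (if m < mixr_last P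
      then min (1 - weight (mixr_h P (Suc m)) / weight (mixr_h P m)) (mixr_r P m)
      else mixr_r P m)"

text \<open>The value of \<open>n\<close> when the loop terminates:\<close>

definition mixr_n :: "packet set \<Rightarrow> nat" where
  "mixr_n P = card {m \<in> {1..mixr_last P}. mixr_r P m > 0}"

text \<open>
  The random choice of a step is the index \<open>k\<close> of the packet \<open>h\<^sub>k\<close> to be transmitted; the index \<open>0\<close>
  stands for transmitting nothing.  The use of \<^const>\<open>embed_pmf\<close> is justified by
  \<open>pmf_mixr_index\<close> below.
\<close>

definition mixr_index :: "packet multiset \<Rightarrow> nat pmf" where
  "mixr_index B =
     (let P = set_mset B in
      if P = {} then return_pmf 0
      else embed_pmf (\<lambda>k. if k \<in> {1..mixr_n P} then mixr_p P k else 0))"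

definition mixr_packet :: "packet multiset \<Rightarrow> nat \<Rightarrow> packet option" where
  "mixr_packet B k = (if k = 0 then None else Some (mixr_h (set_mset B) k))"

definition mixr :: "packet multiset \<Rightarrow> packet option pmf" where
  "mixr B = map_pmf (mixr_packet B) (mixr_index B)"

definition mixr_support_size :: "packet multiset \<Rightarrow> nat" where
  "mixr_support_size B = card {q. pmf (mixr B) (Some q) > 0}"


subsection \<open>Well-definedness of the distribution\<close>

lemma arg_max_on_weight:
  assumes "finite S" "S \<noteq> {}"
  shows "arg_max_on weight S \<in> S \<and> (\<forall>y\<in>S. weight y \<le> weight (arg_max_on weight S))"
proof -
  have "Max (weight ` S) \<in> weight ` S" using assms by (intro Max_in) auto
  then obtain x where x: "x \<in> S" "Max (weight ` S) = weight x" by (rule imageE)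
  have mx: "weight y \<le> weight x" if "y \<in> S" for y
    using that assms by (simp flip: x(2))
  have "is_arg_max weight (\<lambda>x. x \<in> S) x"
    using x(1) mx unfolding is_arg_max_linorder by blast
  then have "is_arg_max weight (\<lambda>x. x \<in> S) (arg_max_on weight S)"
    unfolding arg_max_on_def arg_max_def by (rule someI)
  then show ?thesis unfolding is_arg_max_linorder by blast
qed

lemma dominated_by_trans: "dominated_by a b \<Longrightarrow> dominated_by b c \<Longrightarrow> dominated_by a c"
  by (auto simp: dominated_by_def)

context
  fixes P :: "packet set"
  assumes fin: "finite P" and ne: "P \<noteq> {}" and pos: "\<And>q. q \<in> P \<Longrightarrow> weight q > 0"
begin

lemma mixr_H_subset: "mixr_H P m \<subseteq> P"
  by (induction m) auto

lemma mixr_H_closed: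
  "x \<in> mixr_H P m \<Longrightarrow> y \<in> P \<Longrightarrow> dominated_by x y \<Longrightarrow> y \<in> mixr_H P m"
  by (induction m) (auto dest: dominated_by_trans)

lemma mixr_h_Suc:
  assumes "mixr_H P m \<noteq> {}"
  shows "mixr_h P (Suc m) \<in> mixr_H P m"
    and "y \<in> P \<Longrightarrow> \<not> strictly_dominated_by (mixr_h P (Suc m)) y"
    and "y \<in> mixr_H P m \<Longrightarrow> weight y \<le> weight (mixr_h P (Suc m))"
proof -
  define H where "H = mixr_H P m"
  define S where "S = {x \<in> H. \<not> (\<exists>y\<in>P. strictly_dominated_by x y)}"
  have finH: "finite H" unfolding H_def using mixr_H_subset fin by (rule finite_subset)
  define W where "W = {x \<in> H. \<forall>y\<in>H. weight y \<le> weight x}"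
  have "H \<noteq> {}" using assms by (simp add: H_def)
  then have "arg_max_on weight H \<in> W" using arg_max_on_weight[OF finH] unfolding W_def by blast
  then obtain x where x: "x \<in> W" "\<And>y. y \<in> W \<Longrightarrow> deadline x \<le> deadline y"
    using ex_has_least_nat[of "\<lambda>x. x \<in> W" _ deadline] by blast
  have xH: "x \<in> H" "\<And>y. y \<in> H \<Longrightarrow> weight y \<le> weight x" using x(1) unfolding W_def by blast+
  have "\<not> strictly_dominated_by x y" if "y \<in> P" for y
  proof
    assume "strictly_dominated_by x y"
    then have d: "dominated_by x y" "weight x < weight y \<or> deadline x > deadline y"
      unfolding strictly_dominated_by_def by blast+
    have yH: "y \<in> H" using mixr_H_closed that d(1) xH(1) unfolding H_def by blast
    have "weight x \<le> weight y" using d(1) unfolding dominated_by_def by blast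
    then have "y \<in> W" using xH(2) yH unfolding W_def by (blast intro: order.trans)
    then show False using x(2)[of y] xH(2)[OF yH] d(2) by linarith
  qed
  then have xS: "x \<in> S" using xH(1) unfolding S_def by blast
  have "finite S" using finH unfolding S_def by simp
  moreover have "mixr_h P (Suc m) = arg_max_on weight S"
    by (simp add: S_def H_def heaviest_nondominated_def)
  ultimately have *: "mixr_h P (Suc m) \<in> S" "weight x \<le> weight (mixr_h P (Suc m))"
    using arg_max_on_weight[of S] xS by auto
  show "mixr_h P (Suc m) \<in> mixr_H P m"
    using *(1) unfolding S_def H_def by blast
  show "\<not> strictly_dominated_by (mixr_h P (Suc m)) y" if "y \<in> P"
    using *(1) that unfolding S_def by blast
  show "weight y \<le> weight (mixr_h P (Suc m))" if "y \<in> mixr_H P m"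
    using xH(2)[of y] *(2) that unfolding H_def by linarith
qed

lemma mixr_H_psubset: "mixr_H P m \<noteq> {} \<Longrightarrow> mixr_H P (Suc m) \<subset> mixr_H P m"
  using mixr_h_Suc(1)[of m] by (auto simp: dominated_by_def)

lemma mixr_H_empty_ex: "\<exists>m. mixr_H P m = {}"
proof (rule ccontr)
  assume "\<not> ?thesis"
  then have less: "card (mixr_H P (Suc m)) < card (mixr_H P m)" for m
    using psubset_card_mono[OF finite_subset[OF mixr_H_subset fin] mixr_H_psubset[of m]] by blast
  have "card (mixr_H P m) + m \<le> card P" for m
  proof (induction m)
    case (Suc m)
    with less[of m] show ?case by linarith
  qed simp
  from this[of "Suc (card P)"] show False by simp
qed

lemma mixr_H_last: "mixr_H P (mixr_last P) = {}"
  unfolding mixr_last_def using mixr_H_empty_ex by (rule LeastI_ex)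

lemma mixr_H_before_last: "m < mixr_last P \<Longrightarrow> mixr_H P m \<noteq> {}"
  unfolding mixr_last_def by (rule not_less_Least)

lemma mixr_last_pos: "mixr_last P > 0"
  using mixr_H_last ne by (metis gr0I mixr_H.simps(1))

lemma weight_mixr_h_pos: "m \<le> mixr_last P \<Longrightarrow> weight (mixr_h P m) > 0"
proof (cases m)
  case 0
  then show ?thesis using pos arg_max_on_weight[OF fin ne] by simp
next
  case (Suc j)
  assume "m \<le> mixr_last P"
  then have "mixr_h P m \<in> P"
    using Suc mixr_h_Suc(1)[OF mixr_H_before_last[of j]] mixr_H_subset[of j]
    by (auto simp del: mixr_h.simps(2))
  then show ?thesis by (rule pos)
qed

lemma weight_mixr_h_01: "weight (mixr_h P (Suc 0)) = weight (mixr_h P 0)"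
proof (rule antisym)
  have "mixr_H P 0 \<noteq> {}" using ne by simp
  note h1 = mixr_h_Suc(1,3)[OF this, unfolded mixr_H.simps(1)]
  show "weight (mixr_h P (Suc 0)) \<le> weight (mixr_h P 0)"
    using arg_max_on_weight[OF fin ne] h1(1) unfolding mixr_h.simps(1) by blast
  show "weight (mixr_h P 0) \<le> weight (mixr_h P (Suc 0))"
    using arg_max_on_weight[OF fin ne] unfolding mixr_h.simps(1) by (intro h1(2)) blast
qed

lemma weight_mixr_h_less:
  assumes "Suc m < mixr_last P"
  shows "weight (mixr_h P (Suc (Suc m))) < weight (mixr_h P (Suc m))"
proof -
  let ?a = "mixr_h P (Suc (Suc m))" and ?b = "mixr_h P (Suc m)"
  have a: "?a \<in> mixr_H P (Suc m)" using mixr_h_Suc(1)[OF mixr_H_before_last[OF assms]] .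
  then have aH: "?a \<in> mixr_H P m" and nd: "\<not> dominated_by ?a ?b" by auto
  have "mixr_H P m \<noteq> {}" using aH by blast
  note b = mixr_h_Suc[OF this]
  have "?a \<in> P" using aH mixr_H_subset by blast
  then have "\<not> strictly_dominated_by ?b ?a" by (rule b(2))
  with nd b(3)[OF aH] show ?thesis
    by (auto simp: dominated_by_def strictly_dominated_by_def simp del: mixr_h.simps(2))
qed

lemma mixr_r_Suc: "m < mixr_last P \<Longrightarrow> mixr_r P (Suc m) = mixr_r P m - mixr_p P m"
  by (simp add: mixr_p_def)

lemma mixr_r_nonneg: "0 \<le> mixr_r P m"
  by (cases m) auto

lemma ratio_bounds:
  assumes "m < mixr_last P"
  shows "0 \<le> 1 - weight (mixr_h P (Suc m)) / weight (mixr_h P m)"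
    and "m > 0 \<Longrightarrow> 0 < 1 - weight (mixr_h P (Suc m)) / weight (mixr_h P m)"
proof -
  have p: "weight (mixr_h P m) > 0" using weight_mixr_h_pos[of m] assms by simp
  show less: "0 < 1 - weight (mixr_h P (Suc m)) / weight (mixr_h P m)" if "m > 0"
  proof -
    obtain j where j: "m = Suc j" using \<open>m > 0\<close> by (cases m) auto
    show ?thesis using weight_mixr_h_less[of j] assms p unfolding j
      by (simp add: field_simps del: mixr_h.simps(2))
  qed
  show "0 \<le> 1 - weight (mixr_h P (Suc m)) / weight (mixr_h P m)"
    using less weight_mixr_h_01 p by (cases m) (auto simp del: mixr_h.simps(2))
qed

lemma mixr_p_nonneg: "m \<le> mixr_last P \<Longrightarrow> 0 \<le> mixr_p P m"
  using ratio_bounds(1)[of m] mixr_r_nonneg[of m] by (auto simp: mixr_p_def simp del: mixr_h.simps(2))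

lemma mixr_p_0: "mixr_p P 0 = 0"
  using weight_mixr_h_01 weight_mixr_h_pos[of 0] mixr_last_pos
  by (simp add: mixr_p_def del: mixr_h.simps)

lemma mixr_p_pos_iff: "m \<in> {1..mixr_last P} \<Longrightarrow> 0 < mixr_p P m \<longleftrightarrow> 0 < mixr_r P m"
  using ratio_bounds(2)[of m] by (auto simp: mixr_p_def simp del: mixr_h.simps(2))

lemma mixr_r_antimono: "i \<le> j \<Longrightarrow> j \<le> mixr_last P \<Longrightarrow> mixr_r P j \<le> mixr_r P i"
proof (induction j rule: dec_induct)
  case (step j)
  then show ?case using mixr_r_Suc[of j] mixr_p_nonneg[of j] by (simp del: mixr_r.simps)
qed simp

lemma mixr_n_set: "{m \<in> {1..mixr_last P}. mixr_r P m > 0} = {1..mixr_n P}"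
proof -
  let ?S = "{m \<in> {1..mixr_last P}. mixr_r P m > 0}"
  have "mixr_r P 1 = 1" using mixr_r_Suc[of 0] mixr_p_0 mixr_last_pos by (simp del: mixr_r.simps(2))
  then have "1 \<in> ?S" using mixr_last_pos by simp
  then have ne': "?S \<noteq> {}" by blast
  have "?S = {1..Max ?S}"
  proof (intro set_eqI iffI)
    fix k assume k: "k \<in> ?S"
    have "finite ?S" by simp
    from Max_ge[OF this k] k show "k \<in> {1..Max ?S}" by simp
  next
    fix k assume k: "k \<in> {1..Max ?S}"
    define M where "M = Max ?S"
    have "finite ?S" by simp
    then have "M \<in> ?S" unfolding M_def using ne' by (rule Max_in)
    moreover have "1 \<le> k" "k \<le> M" using k by (auto simp: M_def)
    ultimately show "k \<in> ?S" using mixr_r_antimono[of k M] by simp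
  qed
  then have "mixr_n P = card {1..Max ?S}" unfolding mixr_n_def by (rule arg_cong)
  then have "mixr_n P = Max ?S" by simp
  with \<open>?S = {1..Max ?S}\<close> show ?thesis by simp
qed

lemma mixr_p_pos: "k \<in> {1..mixr_n P} \<Longrightarrow> 0 < mixr_p P k"
  using mixr_n_set mixr_p_pos_iff by blast

lemma sum_mixr_p: "(\<Sum>k\<in>{1..mixr_n P}. mixr_p P k) = 1"
proof -
  let ?L = "mixr_last P"
  have r: "(\<Sum>k<m. mixr_p P k) = 1 - mixr_r P m" if "m \<le> ?L" for m
    using that by (induction m) (auto simp: mixr_r_Suc simp del: mixr_r.simps(2))
  have "(\<Sum>k\<le>?L. mixr_p P k) = 1"
    using r[of ?L] by (simp add: mixr_p_def flip: lessThan_Suc_atMost)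
  moreover have "(\<Sum>k\<le>?L. mixr_p P k) = (\<Sum>k\<in>{1..mixr_n P}. mixr_p P k)"
  proof (rule sum.mono_neutral_right)
    show "{1..mixr_n P} \<subseteq> {..?L}" unfolding mixr_n_set[symmetric] by auto
    show "\<forall>k\<in>{..?L} - {1..mixr_n P}. mixr_p P k = 0"
    proof
      fix k assume k: "k \<in> {..?L} - {1..mixr_n P}"
      show "mixr_p P k = 0"
      proof (cases "k = 0")
        case False
        then have "k \<in> {1..?L}" using k by auto
        moreover have "\<not> 0 < mixr_r P k" using calculation k mixr_n_set by blast
        ultimately show ?thesis using mixr_p_pos_iff mixr_p_nonneg[of k] by force
      qed (simp add: mixr_p_0)
    qed
  qed simp
  ultimately show ?thesis by simp
qed

lemma mixr_h_inj: "inj_on (mixr_h P) {1..mixr_last P}"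
proof -
  have "weight (mixr_h P j) < weight (mixr_h P i)" if "i < j" "1 \<le> i" "j \<le> mixr_last P" for i j
    using that
  proof (induction j rule: less_Suc_induct)
    case (1 i)
    then obtain m where "i = Suc m" by (cases i) auto
    with 1 show ?case using weight_mixr_h_less[of m] by simp
  qed fastforce
  then have "mixr_h P i \<noteq> mixr_h P j" if "i < j" "1 \<le> i" "j \<le> mixr_last P" for i j
    using that by (metis less_irrefl)
  then show ?thesis by (intro linorder_inj_onI) auto
qed

end

lemma
  assumes ne: "B \<noteq> {#}" and pos: "\<And>q. q \<in># B \<Longrightarrow> weight q > 0"
  shows pmf_mixr_index:
      "pmf (mixr_index B) k =
        (if k \<in> {1..mixr_n (set_mset B)} then mixr_p (set_mset B) k else 0)"
    and mixr_support_size_eq: "mixr_support_size B = mixr_n (set_mset B)"  \<comment> \<open>hence all \<open>p\<^sub>1, \<dots>, p\<^sub>n\<close> are positive\<close>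
proof -
  let ?P = "set_mset B"
  let ?f = "\<lambda>k. if k \<in> {1..mixr_n ?P} then mixr_p ?P k else 0"
  have P: "finite ?P" "?P \<noteq> {}" "\<And>q. q \<in> ?P \<Longrightarrow> weight q > 0" using ne pos by auto
  have nonneg: "0 \<le> ?f k" for k using mixr_p_pos[OF P, of k] by auto
  have "(\<integral>\<^sup>+k. ennreal (?f k) \<partial>count_space UNIV) = (\<Sum>k\<in>{1..mixr_n ?P}. ennreal (?f k))"
    by (rule nn_integral_count_space') auto
  also have "\<dots> = ennreal (\<Sum>k\<in>{1..mixr_n ?P}. ?f k)" using nonneg by (rule sum_ennreal)
  also have "\<dots> = 1" using sum_mixr_p[OF P] by simp
  finally have one: "(\<integral>\<^sup>+k. ennreal (?f k) \<partial>count_space UNIV) = 1" .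
  show idx: "pmf (mixr_index B) k = ?f k" for k
    using pmf_embed_pmf[of ?f k] nonneg one P(2) unfolding mixr_index_def Let_def by simp
  then have supp: "set_pmf (mixr_index B) = {1..mixr_n ?P}"
    using mixr_p_pos[OF P] by (force simp: set_pmf_eq)
  have "{q. pmf (mixr B) (Some q) > 0} = {q. Some q \<in> set_pmf (mixr B)}"
    by (simp add: pmf_positive_iff)
  also have "\<dots> = mixr_h ?P ` {1..mixr_n ?P}"
    by (force simp: mixr_def supp mixr_packet_def)
  finally have "mixr_support_size B = card (mixr_h ?P ` {1..mixr_n ?P})"
    by (simp add: mixr_support_size_def)
  also have "\<dots> = card {1..mixr_n ?P}"
  proof (rule card_image)
    have "{1..mixr_n ?P} \<subseteq> {1..mixr_last ?P}"
      by (subst mixr_n_set[OF P, symmetric]) auto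
    then show "inj_on (mixr_h ?P) {1..mixr_n ?P}"
      using mixr_h_inj[OF P] by (blast intro: inj_on_subset)
  qed
  finally show "mixr_support_size B = mixr_n ?P" by simp
qed


section \<open>The game against an adaptive adversary\<close>

text \<open>
  An adaptive adversary is a deterministic strategy.  Its argument is the list of the moves of the
  algorithm in the steps \<open>0, \<dots>, t - 1\<close> (\<^const>\<open>None\<close> if nothing is transmitted): \<open>inject\<close> gives the
  packets injected immediately before step \<open>t\<close>, and \<open>answer\<close> the move of ADV in step \<open>t\<close>, which hence
  does not depend on the random choice of the algorithm in step \<open>t\<close> or later.
\<close>

record adversary =
  inject :: "packet option list \<Rightarrow> packet multiset"
  answer :: "packet option list \<Rightarrow> packet option"

text \<open>The state at the beginning of a step, after the injection preceding that step:\<close>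

record state =
  history :: "packet option list"
  alg_buf :: "packet multiset"
  adv_buf :: "packet multiset"

definition transmit :: "packet option \<Rightarrow> packet multiset \<Rightarrow> packet multiset" where
  "transmit x B = (case x of None \<Rightarrow> B | Some q \<Rightarrow> B - {#q#})"

definition age :: "packet multiset \<Rightarrow> packet multiset" where
  "age B = filter_mset (\<lambda>q. deadline q > 0) (image_mset (\<lambda>(w, d). (w, d - 1)) B)"

definition init_state :: "adversary \<Rightarrow> state" where
  "init_state A = \<lparr>history = [], alg_buf = inject A [], adv_buf = inject A []\<rparr>"

definition next_state :: "adversary \<Rightarrow> state \<Rightarrow> packet option \<Rightarrow> state" where
  "next_state A s x =
     (let h = history s @ [x] in
      \<lparr>history = h,
       alg_buf = age (transmit x (alg_buf s)) + inject A h,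
       adv_buf = age (transmit (answer A (history s)) (adv_buf s)) + inject A h\<rparr>)"

inductive possible_state :: "adversary \<Rightarrow> state \<Rightarrow> bool" for A where
  init: "possible_state A (init_state A)"
| step: "possible_state A s \<Longrightarrow> x \<in> set_pmf (mixr (alg_buf s)) \<Longrightarrow>
           possible_state A (next_state A s x)"

definition legal_adversary :: "adversary \<Rightarrow> bool" where
  "legal_adversary A \<longleftrightarrow>
     (\<forall>s. possible_state A s \<longrightarrow>
        (\<forall>q. q \<in># inject A (history s) \<longrightarrow> weight q > 0 \<and> deadline q > 0) \<and>
        (\<forall>q. answer A (history s) = Some q \<longrightarrow> q \<in># adv_buf s))"

definition support_sizes :: "adversary \<Rightarrow> nat set" where
  "support_sizes A = {mixr_support_size (alg_buf s) | s. possible_state A s}"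


subsection \<open>The probability space of all plays\<close>

text \<open>
  A play is determined by the sequence \<open>\<omega>\<close> of the indices drawn by the algorithm.  Indices are used
  in place of packets because their product spaces are discrete in every finite dimension.
\<close>

primrec run :: "adversary \<Rightarrow> (nat \<Rightarrow> nat) \<Rightarrow> nat \<Rightarrow> state" where
  "run A \<omega> 0 = init_state A"
| "run A \<omega> (Suc t) =
     next_state A (run A \<omega> t) (mixr_packet (alg_buf (run A \<omega> t)) (\<omega> t))"

definition play_kernel :: "adversary \<Rightarrow> nat \<Rightarrow> (nat \<Rightarrow> nat) \<Rightarrow> nat measure" where
  "play_kernel A t \<omega> = measure_pmf (mixr_index (alg_buf (run A \<omega> t)))"

interpretation play: Ionescu_Tulcea "play_kernel A" "\<lambda>_. count_space UNIV" for A
proof (rule Ionescu_Tulcea.intro)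
  fix t :: nat
  have "PiM {0..<t} (\<lambda>_. count_space (UNIV :: nat set)) = count_space ({0..<t} \<rightarrow>\<^sub>E UNIV)"
    by (rule count_space_PiM_finite) simp_all
  then show "play_kernel A t \<in> measurable (PiM {0..<t} (\<lambda>_. count_space UNIV))
          (subprob_algebra (count_space UNIV))"
    by (simp add: play_kernel_def measure_pmf_in_subprob_algebra)
  show "prob_space (play_kernel A t \<omega>)" for \<omega>
    by (simp add: play_kernel_def measure_pmf.prob_space_axioms)
qed

text \<open>
  The law of \<open>\<omega>\<close>: conditionally on \<open>\<omega> 0, \<dots>, \<omega> (t - 1)\<close>, the index \<open>\<omega> t\<close> is distributed according to
  \<^term>\<open>mixr_index (alg_buf (run A \<omega> t))\<close>.
\<close>

definition play_measure :: "adversary \<Rightarrow> (nat \<Rightarrow> nat) measure" where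
  "play_measure A = play.PF.lim A"

definition move_weight :: "packet option \<Rightarrow> ennreal" where
  "move_weight x = (case x of None \<Rightarrow> 0 | Some q \<Rightarrow> ennreal (weight q))"

text \<open>Plays are infinite, so gains and expected gains may be infinite.\<close>

definition alg_gain :: "adversary \<Rightarrow> (nat \<Rightarrow> nat) \<Rightarrow> ennreal" where
  "alg_gain A \<omega> = (\<Sum>t. move_weight (mixr_packet (alg_buf (run A \<omega> t)) (\<omega> t)))"

definition adv_gain :: "adversary \<Rightarrow> (nat \<Rightarrow> nat) \<Rightarrow> ennreal" where
  "adv_gain A \<omega> = (\<Sum>t. move_weight (answer A (history (run A \<omega> t))))"

end

theory Submission
  imports Defs
begin

text \<open>
  The proof is by a potential function.  Match each packet pending for ADV to at most one packet
  pending for MIX-R, injectively and with a deadline that is not earlier; a matched packet costs the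
  part of its weight that exceeds its partner's weight, and an unmatched one costs its weight.  The
  potential is the least cost of such a matching.  Suppose that, in one step, ADV transmits a packet
  whose partner is dominated by \<open>h\<^sub>i\<close>.  If MIX-R transmits \<open>h\<^sub>k\<close> with \<open>k \<ge> i\<close>, then the packet matched to
  \<open>h\<^sub>k\<close> can be rematched to the partner that became free, and the gain of ADV plus the change of the
  potential is at most \<open>w\<^sub>i\<close>; if \<open>k < i\<close>, leaving that packet unmatched gives the bound \<open>w\<^sub>i + w\<^sub>k\<close>.
  As \<open>p\<^sub>k w\<^sub>k \<le> w\<^sub>k - w\<^bsub>k+1\<^esub>\<close>, the expectation telescopes to at most \<open>w\<^sub>1\<close>.  The expected gain of MIX-R in
  the step is \<open>w\<^sub>1 (1 - (1 - p\<^sub>1) \<cdots> (1 - p\<^sub>n))\<close>, which the inequality of arithmetic and geometric means,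
  applied to \<open>1 - p\<^sub>1, \<dots>, 1 - p\<^sub>n\<close> padded with \<open>N - n\<close> ones, bounds below by
  \<open>(1 - (1 - 1/N)\<^sup>N) w\<^sub>1\<close>.
\<close>


section \<open>Matchings between buffers\<close>

text \<open>\<open>a\<close> stands for the buffer of MIX-R and \<open>b\<close> for that of ADV.
  The number is only an upper bound on the cost of a matching, hence the inequalities in the rules.
  Peeling packets off \<open>b\<close> encodes an injective partial matching even though equal
  packets may repeat.\<close>

inductive matched :: "packet multiset \<Rightarrow> packet multiset \<Rightarrow> real \<Rightarrow> bool" where
  empty: "0 \<le> x \<Longrightarrow> matched a {#} x"
| pair: "matched a b x \<Longrightarrow> 0 \<le> weight q \<Longrightarrow> deadline q \<le> deadline q' \<Longrightarrow>
    x + max 0 (weight q - weight q') \<le> y \<Longrightarrow> matched (add_mset q' a) (add_mset q b) y"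
| single: "matched a b x \<Longrightarrow> 0 \<le> weight q \<Longrightarrow> x + weight q \<le> y \<Longrightarrow> matched a (add_mset q b) y"

lemma matched_nonneg: "matched a b x \<Longrightarrow> 0 \<le> x"
  by (induction rule: matched.induct) auto

lemma matched_mono: "matched a b x \<Longrightarrow> x \<le> y \<Longrightarrow> matched (a + c) b y"
proof (induction arbitrary: y rule: matched.induct)
  case (pair a b x q q' z)
  show ?case using matched.pair[OF pair.IH[OF order_refl], of q q' y] pair by simp
next
  case (single a b x q z)
  show ?case using matched.single[OF single.IH[OF order_refl], of q y] single by simp
qed (auto intro: matched.empty)

lemma matched_le: "matched a b x \<Longrightarrow> x \<le> y \<Longrightarrow> matched a b y"
  using matched_mono[of a b x y "{#}"] by simp

text \<open>Each packet of \<open>c\<close> is matched to its own copy at cost 0. This handles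
  injections as well as the initial buffers.\<close>

lemma matched_add_same:
  assumes "matched a b x" "\<And>q. q \<in># c \<Longrightarrow> 0 \<le> weight q"
  shows "matched (a + c) (b + c) x"
  using assms(2)
proof (induction c)
  case (add q c)
  then have "matched (a + c) (b + c) x" by simp
  then show ?case using matched.pair[of "a + c" "b + c" x q q x] add.prems by simp
qed (simp add: assms(1))

section \<open>How aging and transmissions change the cost of a matching\<close>

lemma age_empty: "age {#} = {#}"
  by (simp add: age_def)

lemma age_add_mset:
  "age (add_mset q B) =
     (if 1 < deadline q then add_mset (weight q, deadline q - 1) (age B) else age B)"
  by (cases q) (auto simp: age_def)

text \<open>A partner expires no earlier than the packet matched to it. So every pair either
  survives intact or loses its ADV packet, which can only lower the cost.\<close>

lemma matched_age: "matched a b x \<Longrightarrow> matched (age a) (age b) x"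
proof (induction rule: matched.induct)
  case (pair a b x q q' y)
  show ?case
  proof (cases "1 < deadline q")
    case True
    then show ?thesis
      using pair matched.pair[OF pair.IH, of "(weight q, deadline q - 1)" "(weight q', deadline q' - 1)" y]
      by (simp add: age_add_mset)
  next
    case False
    have "x \<le> y" using pair.hyps by simp
    with False pair.IH show ?thesis
      using matched_mono[of "age a" "age b" x y "{#(weight q', deadline q' - 1)#}"] matched_le
      by (simp add: age_add_mset)
  qed
next
  case (single a b x q y)
  show ?case
  proof (cases "1 < deadline q")
    case True
    then show ?thesis
      using single matched.single[OF single.IH, of "(weight q, deadline q - 1)" y]
      by (simp add: age_add_mset)
  next
    case False
    have "x \<le> y" using single.hyps by simp
    with False single.IH show ?thesis using matched_le by (simp add: age_add_mset)
  qed
qed (auto simp: age_empty intro: matched.empty)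

text \<open>The two cases are \<open>z\<close> unmatched and \<open>z\<close> matched to
  \<open>z'\<close>. In the second, \<open>z'\<close> is taken out as well, so that it is free to
  serve another packet.\<close>

lemma matched_remove_right:
  assumes "matched a b x" "z \<in># b"
  shows "matched a (b - {#z#}) (x - weight z) \<or>
    (\<exists>z'. z' \<in># a \<and> deadline z \<le> deadline z' \<and>
       matched (a - {#z'#}) (b - {#z#}) (x - max 0 (weight z - weight z')))"
  using assms
proof (induction rule: matched.induct)
  case (pair a b x q q' y)
  show ?case
  proof (cases "z = q")
    case True
    have "matched a b (y - max 0 (weight q - weight q'))"
      using pair.hyps by (intro matched_le[OF pair.hyps(1)]) simp
    then have "q' \<in># add_mset q' a \<and> deadline z \<le> deadline q' \<and>
       matched (add_mset q' a - {#q'#}) (add_mset q b - {#z#}) (y - max 0 (weight z - weight q'))"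
      using True pair.hyps by simp
    then show ?thesis by blast
  next
    case False
    then have z: "z \<in># b" "add_mset q b - {#z#} = add_mset q (b - {#z#})"
      using pair.prems by auto
    from pair.IH[OF z(1)] show ?thesis
    proof (elim disjE exE conjE)
      assume "matched a (b - {#z#}) (x - weight z)"
      then show ?thesis using pair.hyps z(2) matched.pair[of a "b - {#z#}" "x - weight z" q q' "y - weight z"]
        by simp
    next
      fix z' assume z': "z' \<in># a" "deadline z \<le> deadline z'"
        "matched (a - {#z'#}) (b - {#z#}) (x - max 0 (weight z - weight z'))"
      have eq: "add_mset q' a - {#z'#} = add_mset q' (a - {#z'#})" using z'(1) by simp
      have "matched (add_mset q' a - {#z'#}) (add_mset q b - {#z#}) (y - max 0 (weight z - weight z'))"
        unfolding z(2) eq using pair.hyps by (intro matched.pair[OF z'(3)]) auto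
      moreover have "z' \<in># add_mset q' a" using z'(1) by simp
      ultimately show ?thesis using z'(2) by blast
    qed
  qed
next
  case (single a b x q y)
  show ?case
  proof (cases "z = q")
    case True
    have "matched a b (y - weight q)"
      using single.hyps by (intro matched_le[OF single.hyps(1)]) simp
    then show ?thesis using True by simp
  next
    case False
    then have z: "z \<in># b" "add_mset q b - {#z#} = add_mset q (b - {#z#})"
      using single.prems by auto
    from single.IH[OF z(1)] show ?thesis
    proof (elim disjE exE conjE)
      assume "matched a (b - {#z#}) (x - weight z)"
      then show ?thesis
        using single.hyps z(2) matched.single[of a "b - {#z#}" "x - weight z" q "y - weight z"] by simp
    next
      fix z' assume z': "z' \<in># a" "deadline z \<le> deadline z'"
        "matched (a - {#z'#}) (b - {#z#}) (x - max 0 (weight z - weight z'))"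
      have "matched (a - {#z'#}) (add_mset q b - {#z#}) (y - max 0 (weight z - weight z'))"
        unfolding z(2) using single.hyps by (intro matched.single[OF z'(3)]) auto
      then show ?thesis using z' by blast
    qed
  qed
qed simp

text \<open>If a packet \<open>q\<close> was matched to \<open>h\<close>, it becomes unmatched, and
  its cost grows by the minimum of the weights of \<open>q\<close> and \<open>h\<close>.\<close>

lemma matched_remove_left:
  assumes "matched a b x" "h \<in># a" "0 \<le> weight h"
  shows "matched (a - {#h#}) b (x + weight h)"
  using assms
proof (induction rule: matched.induct)
  case (pair a b x q q' y)
  show ?case
  proof (cases "h = q'")
    case True
    then show ?thesis using pair.hyps matched.single[OF pair.hyps(1), of q "y + weight h"] by auto
  next
    case False
    then have h: "h \<in># a" "add_mset q' a - {#h#} = add_mset q' (a - {#h#})"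
      using pair.prems by auto
    show ?thesis unfolding h(2)
      using pair.hyps pair.prems by (intro matched.pair[OF pair.IH[OF h(1)]]) auto
  qed
next
  case (single a b x q y)
  then show ?case by (intro matched.single[OF single.IH]) auto
qed (auto intro: matched.empty)

text \<open>A packet matched to \<open>h\<close> is rematched to \<open>h'\<close>, which expires no
  earlier. Its cost grows at most by the weight that \<open>h'\<close> lacks in comparison with
  \<open>h\<close>.\<close>

lemma matched_replace:
  assumes "matched a b x" "h \<in># a" "deadline h \<le> deadline h'"
  shows "matched (add_mset h' (a - {#h#})) b (x + max 0 (weight h - weight h'))"
  using assms
proof (induction rule: matched.induct)
  case (pair a b x q q' y)
  show ?case
  proof (cases "h = q'")
    case True
    then show ?thesis
      using pair.hyps pair.prems
        matched.pair[OF pair.hyps(1), of q h' "y + max 0 (weight h - weight h')"] by auto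
  next
    case False
    then have h: "h \<in># a"
      "add_mset h' (add_mset q' a - {#h#}) = add_mset q' (add_mset h' (a - {#h#}))"
      using pair.prems by auto
    show ?thesis unfolding h(2)
      using pair.hyps pair.prems by (intro matched.pair[OF pair.IH[OF h(1)]]) auto
  qed
next
  case (single a b x q y)
  then show ?case by (intro matched.single[OF single.IH]) auto
qed (auto intro: matched.empty)

text \<open>ADV transmits \<open>z\<close> and MIX-R transmits \<open>h\<close>. The amount added to
  \<open>x - weight z\<close> bounds the gain of ADV plus the change of the cost. Once
  \<open>z\<close> has left, its partner \<open>z'\<close> can either stay idle or take over the
  packet matched to \<open>h\<close>.\<close>

lemma matched_transmit:
  assumes "matched a b x" "z \<in># b" "\<And>q. q \<in># a \<Longrightarrow> 0 \<le> weight q"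
  obtains (unmatched) "\<And>h. h \<in># a \<Longrightarrow> matched (a - {#h#}) (b - {#z#}) (x - weight z + weight h)"
  | (matched) z' where "z' \<in># a"
      "\<And>h. h \<in># a \<Longrightarrow> matched (a - {#h#}) (b - {#z#}) (x - weight z + (weight z' + weight h))"
      "\<And>h. h \<in># a \<Longrightarrow> deadline h \<le> deadline z' \<Longrightarrow>
         matched (a - {#h#}) (b - {#z#}) (x - weight z + max (weight z') (weight h))"
  using matched_remove_right[OF assms(1,2)]
proof (elim disjE exE conjE)
  assume *: "matched a (b - {#z#}) (x - weight z)"
  show thesis by (rule unmatched) (use matched_remove_left[OF *] assms(3) in blast)
next
  fix z' assume z': "z' \<in># a" "deadline z \<le> deadline z'"
  obtain a' where a: "a = add_mset z' a'" using z'(1) by (metis insert_DiffM)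
  assume "matched (a - {#z'#}) (b - {#z#}) (x - max 0 (weight z - weight z'))"
  then have "matched (a - {#z'#}) (b - {#z#}) (x - weight z + weight z')"
    by (rule matched_le) simp
  then have *: "matched a' (b - {#z#}) (x - weight z + weight z')"
    by (simp add: a)
  have nn: "0 \<le> weight z'" using z'(1) assms(3) by blast
  show thesis
  proof (rule matched)
    fix h assume h: "h \<in># a"
    then have nh: "0 \<le> weight h" using assms(3) by blast
    show "matched (a - {#h#}) (b - {#z#}) (x - weight z + (weight z' + weight h))"
    proof (cases "h = z'")
      case True
      have "matched a' (b - {#z#}) (x - weight z + (weight z' + weight h))"
        by (rule matched_le[OF *]) (use nh in simp)
      then show ?thesis by (simp add: a True)
    next
      case False
      then have "h \<in># a'" "a - {#h#} = a' - {#h#} + {#z'#}" using h by (auto simp: a)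
      \<comment> \<open>Here \<open>z'\<close> returns to the buffer as a spare packet.\<close>
      with matched_mono[OF matched_remove_left[OF * this(1) nh] order_refl, of "{#z'#}"]
      show ?thesis by (simp add: add.assoc)
    qed
    show "matched (a - {#h#}) (b - {#z#}) (x - weight z + max (weight z') (weight h))"
      if "deadline h \<le> deadline z'"
    proof (cases "h = z'")
      case True
      have "matched a' (b - {#z#}) (x - weight z + max (weight z') (weight h))"
        by (rule matched_le[OF *]) simp
      then show ?thesis by (simp add: a True)
    next
      case False
      then have eq: "h \<in># a'" "a - {#h#} = add_mset z' (a' - {#h#})" using h by (auto simp: a)
      \<comment> \<open>\<open>weight z'\<close> plus the loss
        \<open>max 0 (weight h - weight z')\<close> is the larger of the two weights.\<close>
      show ?thesis unfolding eq(2)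
        by (rule matched_le[OF matched_replace[OF * eq(1) that]]) simp
    qed
  qed (rule z'(1))
qed

text \<open>The potential. All further arguments reach it through \<open>excess_le\<close>, which
  exhibits one matching, and \<open>le_excess\<close>, which considers all of them.\<close>

definition excess :: "packet multiset \<Rightarrow> packet multiset \<Rightarrow> real" where
  "excess a b = Inf {x. matched a b x}"

lemma excess_le: "matched a b x \<Longrightarrow> excess a b \<le> x"
  unfolding excess_def by (rule cInf_lower) (auto intro: bdd_belowI[of _ 0] matched_nonneg)

text \<open>Leaving all of \<open>b\<close> unmatched is always possible, so the infimum is over a
  nonempty set.\<close>

lemma matched_exists:
  assumes "\<And>q. q \<in># b \<Longrightarrow> 0 \<le> weight q"
  shows "\<exists>x. matched a b x"
  using assms
proof (induction b)
  case empty
  show ?case using matched.empty[of 0] by blast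
next
  case (add q b)
  then obtain x where "matched a b x" by auto
  then show ?case using add.prems matched.single[of a b x q "x + weight q"] by auto
qed

lemma le_excess:
  assumes "\<And>q. q \<in># b \<Longrightarrow> 0 \<le> weight q" "\<And>x. matched a b x \<Longrightarrow> y \<le> x"
  shows "y \<le> excess a b"
  unfolding excess_def using matched_exists[of b a] assms by (intro cInf_greatest) auto

lemma excess_nonneg: "(\<And>q. q \<in># b \<Longrightarrow> 0 \<le> weight q) \<Longrightarrow> 0 \<le> excess a b"
  by (rule le_excess) (auto intro: matched_nonneg)

lemma excess_same:
  assumes "\<And>q. q \<in># b \<Longrightarrow> 0 \<le> weight q"
  shows "excess b b = 0"
proof (rule antisym)
  show "excess b b \<le> 0"
    using matched_add_same[OF matched.empty[of 0 "{#}"], of b] assms by (intro excess_le) simp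
qed (rule excess_nonneg[OF assms])


section \<open>The distribution of a step\<close>

lemma prod_one_minus_le:
  fixes p :: "nat \<Rightarrow> real"
  assumes N: "1 \<le> N" and n: "n \<le> N" and p: "\<And>k. k \<in> {1..n} \<Longrightarrow> p k \<le> 1"
    and sum: "(\<Sum>k\<in>{1..n}. p k) = 1"
  shows "(\<Prod>k\<in>{1..n}. 1 - p k) \<le> (1 - 1 / real N) ^ N"
proof -
  \<comment> \<open>Padding by zeros adds factors 1 to the product and nothing to the sum. The mean
    of the \<open>N\<close> numbers \<open>1 - q k\<close> is thus \<open>1 - 1/N\<close>, whatever
    \<open>n\<close> is.\<close>
  define q where "q k = (if k \<le> n then p k else 0)" for k
  have sq: "(\<Sum>k\<in>{1..N}. q k) = 1"
    using n sum.mono_neutral_cong_right[of "{1..N}" "{1..n}" q p] sum by (auto simp: q_def)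
  have pq: "(\<Prod>k\<in>{1..N}. 1 - q k) = (\<Prod>k\<in>{1..n}. 1 - p k)"
    using n by (intro prod.mono_neutral_cong_right) (auto simp: q_def)
  have nn: "0 \<le> 1 - q k" if "k \<in> {1..N}" for k using that p by (auto simp: q_def)
  have nnp: "0 \<le> (\<Prod>k\<in>{1..N}. 1 - q k)" using nn by (intro prod_nonneg) auto
  have "(\<Prod>k\<in>{1..N}. 1 - q k) powr (1 / card {1..N}) \<le> (\<Sum>k\<in>{1..N}. (1 - q k) / card {1..N})"
    using N nn by (intro arith_geom_mean) auto
  also have "\<dots> = 1 - 1 / real N"
    using N sq by (simp add: sum_subtractf diff_divide_distrib flip: sum_divide_distrib)
  finally have "((\<Prod>k\<in>{1..N}. 1 - q k) powr (1 / real N)) ^ N \<le> (1 - 1 / real N) ^ N"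
    by (intro power_mono) auto
  moreover have "((\<Prod>k\<in>{1..N}. 1 - q k) powr (1 / real N)) ^ N = (\<Prod>k\<in>{1..N}. 1 - q k)"
  proof (cases "(\<Prod>k\<in>{1..N}. 1 - q k) = 0")
    case True
    show ?thesis unfolding True using N by simp
  qed (use N nnp in \<open>simp add: powr_power\<close>)
  ultimately show ?thesis using pq by simp
qed

section \<open>The order of the packets h_1, h_2, ... and the expected weight transmitted\<close>

context
  fixes P :: "packet set"
  assumes fin: "finite P" and ne: "P \<noteq> {}" and pos: "\<And>q. q \<in> P \<Longrightarrow> weight q > 0"
begin

lemma mixr_h_in: "k \<in> {1..mixr_last P} \<Longrightarrow> mixr_h P k \<in> P"
  using mixr_h_Suc(1)[OF fin ne pos mixr_H_before_last[OF fin ne pos, of "k - 1"]]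
    mixr_H_subset[OF fin ne pos, of "k - 1"]
  by (cases k) (auto simp del: mixr_h.simps(2))

lemma mixr_n_le_last: "mixr_n P \<le> mixr_last P"
proof -
  have "{1..mixr_n P} \<subseteq> {1..mixr_last P}" by (subst mixr_n_set[OF fin ne pos, symmetric]) auto
  then show ?thesis by (cases "mixr_n P = 0") auto
qed

lemma mixr_p_le_1: "k \<in> {1..mixr_n P} \<Longrightarrow> mixr_p P k \<le> 1"
  using member_le_sum[of k "{1..mixr_n P}" "mixr_p P"] mixr_p_pos[OF fin ne pos]
    sum_mixr_p[OF fin ne pos] by (force intro: less_imp_le)

text \<open>h_(j+1) is lighter than h_j and has survived the removal of the packets dominated by
  h_j, so its deadline must be earlier.\<close>

lemma weight_deadline_mixr_h_antimono:
  assumes "1 \<le> i" "i \<le> j" "j \<le> mixr_last P"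
  shows "weight (mixr_h P j) \<le> weight (mixr_h P i) \<and> deadline (mixr_h P j) \<le> deadline (mixr_h P i)"
  using assms(2,3)
proof (induction j rule: dec_induct)
  case (step j)
  then obtain m where m: "j = Suc m" using assms(1) by (cases j) auto
  have less: "weight (mixr_h P (Suc j)) < weight (mixr_h P j)"
    unfolding m using weight_mixr_h_less[OF fin ne pos, of m] step m by (simp del: mixr_h.simps)
  have "mixr_h P (Suc j) \<in> mixr_H P j"
    using mixr_h_Suc(1)[OF fin ne pos mixr_H_before_last[OF fin ne pos, of j]] step by simp
  then have "\<not> dominated_by (mixr_h P (Suc j)) (mixr_h P j)" unfolding m by simp
  then show ?case using less step unfolding dominated_by_def by (simp del: mixr_h.simps)
qed simp

text \<open>The sets \<open>mixr_H P m\<close> shrink to the empty set, and the iteration that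
  removes \<open>z\<close> supplies the dominating packet.\<close>

lemma dominated_by_mixr_h:
  assumes "z \<in> P"
  obtains i where "i \<in> {1..mixr_last P}" "dominated_by z (mixr_h P i)"
proof -
  have "\<exists>i\<in>{1..m}. dominated_by z (mixr_h P i)" if "z \<notin> mixr_H P m" for m
    using that
  proof (induction m)
    case (Suc m)
    show ?case
    proof (cases "z \<in> mixr_H P m")
      case True
      then have "dominated_by z (mixr_h P (Suc m))" using Suc.prems by simp
      then show ?thesis by (intro bexI[of _ "Suc m"]) auto
    next
      case False
      then show ?thesis using Suc.IH by force
    qed
  qed (simp add: assms)
  from this[of "mixr_last P"] that mixr_H_last[OF fin ne pos] show ?thesis by auto
qed

lemma mixr_p_weight_le:
  assumes "k \<in> {1..<mixr_last P}"
  shows "mixr_p P k * weight (mixr_h P k) \<le> weight (mixr_h P k) - weight (mixr_h P (Suc k))"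
proof -
  have w: "0 < weight (mixr_h P k)" using weight_mixr_h_pos[OF fin ne pos, of k] assms by simp
  have "mixr_p P k \<le> 1 - weight (mixr_h P (Suc k)) / weight (mixr_h P k)"
    using assms by (simp add: mixr_p_def del: mixr_h.simps)
  from mult_right_mono[OF this less_imp_le[OF w]] w show ?thesis
    by (simp add: left_diff_distrib del: mixr_h.simps)
qed

text \<open>The bounds of \<open>mixr_p_weight_le\<close> telescope. This controls the extra charge
  in the case that the transmitted packet precedes h_i.\<close>

lemma sum_mixr_p_weight_less:
  assumes i: "i \<in> {1..mixr_last P}"
  shows "(\<Sum>k | k \<in> {1..mixr_n P} \<and> k < i. mixr_p P k * weight (mixr_h P k))
    \<le> weight (mixr_h P 1) - weight (mixr_h P i)"
proof -
  have "(\<Sum>k | k \<in> {1..mixr_n P} \<and> k < i. mixr_p P k * weight (mixr_h P k))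
      \<le> (\<Sum>k\<in>{1..<i}. mixr_p P k * weight (mixr_h P k))"
  proof (rule sum_mono2)
    fix k assume "k \<in> {1..<i} - {k. k \<in> {1..mixr_n P} \<and> k < i}"
    then have "k \<le> mixr_last P" using i by auto
    then show "0 \<le> mixr_p P k * weight (mixr_h P k)"
      using mixr_p_nonneg[OF fin ne pos, of k] weight_mixr_h_pos[OF fin ne pos, of k] by simp
  qed auto
  also have "\<dots> \<le> (\<Sum>k\<in>{1..<i}. weight (mixr_h P k) - weight (mixr_h P (Suc k)))"
    using i by (intro sum_mono mixr_p_weight_le) auto
  also have "\<dots> = weight (mixr_h P 1) - weight (mixr_h P i)"
    using i sum_Suc_diff'[of 1 i "\<lambda>k. - weight (mixr_h P k)"] by (simp del: mixr_h.simps)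
  finally show ?thesis .
qed

lemma sum_mixr_p_weight_le:
  "(\<Sum>k\<in>{1..mixr_n P}. mixr_p P k * weight (mixr_h P k)) \<le> weight (mixr_h P 1)"
proof -
  have "(\<Sum>k\<in>{1..mixr_n P}. mixr_p P k * weight (mixr_h P k))
      \<le> (\<Sum>k\<in>{1..mixr_n P}. mixr_p P k * weight (mixr_h P 1))"
    using mixr_p_pos[OF fin ne pos] weight_deadline_mixr_h_antimono mixr_n_le_last
    by (intro sum_mono mult_left_mono) (auto intro: less_imp_le simp del: mixr_h.simps)
  then show ?thesis using sum_mixr_p[OF fin ne pos]
    by (simp flip: sum_distrib_right del: mixr_h.simps)
qed

text \<open>Write w_k and p_k for the weight and the probability of h_k. Before the last index p_k
  is exactly 1 - w_(k+1)/w_k, so w_k is w_1 times the product of the earlier factors 1 - p_j, and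
  the sum of p_k w_k telescopes.\<close>

lemma sum_mixr_p_weight_eq:
  "(\<Sum>k\<in>{1..mixr_n P}. mixr_p P k * weight (mixr_h P k))
     = weight (mixr_h P 1) * (1 - (\<Prod>k\<in>{1..mixr_n P}. 1 - mixr_p P k))"
proof -
  let ?w = "\<lambda>k. weight (mixr_h P k)" and ?p = "mixr_p P"
  have next_weight: "?w (Suc k) = ?w k * (1 - ?p k)" if k: "k \<in> {1..<mixr_n P}" for k
  proof -
    have kl: "k < mixr_last P" using k mixr_n_le_last by simp
    have "Suc k \<in> {1..mixr_n P}" using k by simp
    \<comment> \<open>If the minimum in p_k were the remaining probability, nothing would remain
      after index \<open>k\<close>.\<close>
    then have "0 < mixr_r P (Suc k)" using mixr_n_set[OF fin ne pos] by blast
    then have "?p k = 1 - ?w (Suc k) / ?w k"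
      using kl by (auto simp: mixr_p_def min_def simp del: mixr_h.simps split: if_splits)
    then show ?thesis using weight_mixr_h_pos[OF fin ne pos, of k] kl by (simp del: mixr_h.simps)
  qed
  have weight_prod: "?w (Suc j) = ?w 1 * (\<Prod>k\<in>{1..j}. 1 - ?p k)" if "j < mixr_n P" for j
    using that
  proof (induction j)
    case (Suc j)
    then show ?case using next_weight[of "Suc j"]
      by (simp add: atLeastAtMostSuc_conv del: mixr_h.simps)
  qed simp
  have "(\<Sum>k\<in>{1..j}. ?p k * ?w k) = ?w 1 * (1 - (\<Prod>k\<in>{1..j}. 1 - ?p k))" if "j \<le> mixr_n P" for j
    using that
  proof (induction j)
    case (Suc j)
    then show ?case using weight_prod[of j]
      by (simp add: atLeastAtMostSuc_conv algebra_simps del: mixr_h.simps)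
  qed simp
  from this[of "mixr_n P"] show ?thesis by simp
qed

lemma sum_mixr_p_weight_ge:
  assumes "1 \<le> N" "mixr_n P \<le> N"
  shows "(1 - (1 - 1 / real N) ^ N) * weight (mixr_h P 1)
    \<le> (\<Sum>k\<in>{1..mixr_n P}. mixr_p P k * weight (mixr_h P k))"
proof -
  have "(\<Prod>k\<in>{1..mixr_n P}. 1 - mixr_p P k) \<le> (1 - 1 / real N) ^ N"
    using assms mixr_p_le_1 sum_mixr_p[OF fin ne pos] by (intro prod_one_minus_le) auto
  moreover have "0 < weight (mixr_h P 1)"
    using weight_mixr_h_pos[OF fin ne pos, of 1] mixr_last_pos[OF fin ne pos] by simp
  ultimately show ?thesis
    unfolding sum_mixr_p_weight_eq by (simp add: mult.commute mult_left_mono del: mixr_h.simps)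
qed

end


section \<open>The amortized gain in a step\<close>

definition move_value :: "packet option \<Rightarrow> real" where
  "move_value x = (case x of None \<Rightarrow> 0 | Some q \<Rightarrow> weight q)"

lemma move_weight_eq: "move_weight x = ennreal (move_value x)"
  by (simp add: move_weight_def move_value_def split: option.split)

text \<open>For a fixed matching, \<open>g k\<close> bounds the gain of ADV plus the change of the
  cost when MIX-R transmits h_k. Its expectation is at most the weight of h_1.\<close>

lemma matched_step:
  assumes ne: "a \<noteq> {#}" and pos: "\<And>q. q \<in># a \<Longrightarrow> weight q > 0"
    and z: "\<And>q. z = Some q \<Longrightarrow> q \<in># b" and m: "matched a b x"
  obtains (charge) g where
    "\<And>k. k \<in> {1..mixr_n (set_mset a)} \<Longrightarrow>
       matched (a - {#mixr_h (set_mset a) k#}) (transmit z b) (x - move_value z + g k)"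
    "(\<Sum>k\<in>{1..mixr_n (set_mset a)}. mixr_p (set_mset a) k * g k) \<le> weight (mixr_h (set_mset a) 1)"
proof -
  define P where "P = set_mset a"
  have P: "finite P" "P \<noteq> {}" "\<And>q. q \<in> P \<Longrightarrow> weight q > 0" using ne pos by (auto simp: P_def)
  have nn: "0 \<le> weight q" if "q \<in># a" for q using pos[OF that] by simp
  have h: "mixr_h P k \<in># a" if "k \<in> {1..mixr_n P}" for k
    using mixr_h_in[OF P, of k] mixr_n_le_last[OF P] that by (auto simp: P_def)
  \<comment> \<open>If ADV is idle or transmits an unmatched packet, only the loss of h_k is
    charged: \<open>g k\<close> is its weight.\<close>
  have all: thesis if "\<And>h. h \<in># a \<Longrightarrow> matched (a - {#h#}) (transmit z b) (x - move_value z + weight h)"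
    by (rule charge[of "\<lambda>k. weight (mixr_h P k)", folded P_def])
      (use h that sum_mixr_p_weight_le[OF P] in auto)
  show thesis
  proof (cases z)
    case None
    show thesis
      by (rule all) (use matched_remove_left[OF m] nn in \<open>simp add: None transmit_def move_value_def\<close>)
  next
    case (Some q)
    note Some_simps = Some transmit_def move_value_def
    show thesis
    proof (rule matched_transmit[OF m z[OF Some] nn])
      assume "\<And>h. h \<in># a \<Longrightarrow> matched (a - {#h#}) (b - {#q#}) (x - weight q + weight h)"
      then show thesis by (intro all) (simp add: Some_simps)
    next
      fix z' assume z': "z' \<in># a"
        and both: "\<And>h. h \<in># a \<Longrightarrow>
          matched (a - {#h#}) (b - {#q#}) (x - weight q + (weight z' + weight h))"
        and swap: "\<And>h. h \<in># a \<Longrightarrow> deadline h \<le> deadline z' \<Longrightarrow>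
          matched (a - {#h#}) (b - {#q#}) (x - weight q + max (weight z') (weight h))"
      obtain i where i: "i \<in> {1..mixr_last P}" "dominated_by z' (mixr_h P i)"
        using dominated_by_mixr_h[OF P, of z'] z' by (auto simp: P_def)
      let ?w = "\<lambda>k. weight (mixr_h P k)"
      have wz: "weight z' \<le> ?w i" and dz: "deadline (mixr_h P i) \<le> deadline z'"
        using i(2) by (auto simp: dominated_by_def)
      \<comment> \<open>For \<open>k < i\<close> the deadline of h_k may exceed that of
        \<open>z'\<close>, so the packet matched to h_k is left unmatched and the weight of h_k is
        added.\<close>
      define g where "g k = ?w i + (if k < i then ?w k else 0)" for k
      have "matched (a - {#mixr_h P k#}) (b - {#q#}) (x - weight q + g k)" if k: "k \<in> {1..mixr_n P}" for k
      proof (cases "k < i")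
        case True
        then show ?thesis by (intro matched_le[OF both[OF h[OF k]]]) (use wz in \<open>simp add: g_def\<close>)
      next
        case False
        \<comment> \<open>From index \<open>i\<close> on, h_k expires no later than h_i, hence no
          later than \<open>z'\<close>, which can therefore replace it. Neither of the two is
          heavier than h_i.\<close>
        then have "?w k \<le> ?w i \<and> deadline (mixr_h P k) \<le> deadline (mixr_h P i)"
          using i(1) k mixr_n_le_last[OF P] by (intro weight_deadline_mixr_h_antimono[OF P]) auto
        then show ?thesis using False wz dz
          by (intro matched_le[OF swap[OF h[OF k]]]) (auto simp: g_def)
      qed
      moreover have "(\<Sum>k\<in>{1..mixr_n P}. mixr_p P k * g k) \<le> ?w 1"
      proof -
        have "(\<Sum>k\<in>{1..mixr_n P}. mixr_p P k * g k) =
            (\<Sum>k\<in>{1..mixr_n P}. mixr_p P k * ?w i) +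
            (\<Sum>k\<in>{1..mixr_n P}. if k < i then mixr_p P k * ?w k else 0)"
          unfolding g_def sum.distrib[symmetric] by (intro sum.cong) (auto simp: distrib_left)
        also have "(\<Sum>k\<in>{1..mixr_n P}. mixr_p P k * ?w i) = ?w i"
          using sum_mixr_p[OF P] by (simp flip: sum_distrib_right)
        also have "(\<Sum>k\<in>{1..mixr_n P}. if k < i then mixr_p P k * ?w k else 0) =
            (\<Sum>k | k \<in> {1..mixr_n P} \<and> k < i. mixr_p P k * ?w k)"
          by (rule sum.inter_filter[symmetric]) simp
        finally show ?thesis using sum_mixr_p_weight_less[OF P i(1)] by linarith
      qed
      ultimately show thesis by (intro charge[of g, folded P_def]) (simp_all add: Some_simps)
    qed
  qed
qed

section \<open>Positivity of pending weights and the expected change of the potential\<close>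

lemma possible_state_weight_pos:
  assumes "legal_adversary A" "possible_state A s"
  shows "(\<forall>q. q \<in># alg_buf s \<longrightarrow> weight q > 0) \<and> (\<forall>q. q \<in># adv_buf s \<longrightarrow> weight q > 0)"
  using assms(2)
proof (induction rule: possible_state.induct)
  case init
  have "possible_state A (init_state A)" by (rule possible_state.init)
  then have "\<forall>q. q \<in># inject A (history (init_state A)) \<longrightarrow> weight q > 0"
    using assms(1) unfolding legal_adversary_def by blast
  then show ?case by (simp add: init_state_def)
next
  case (step s x)
  have "possible_state A (next_state A s x)" using step.hyps by (rule possible_state.step)
  then have "\<forall>q. q \<in># inject A (history (next_state A s x)) \<longrightarrow> weight q > 0"
    using assms(1) unfolding legal_adversary_def by blast
  moreover have "weight q > 0" if "q \<in># age (transmit y B)" "\<forall>q. q \<in># B \<longrightarrow> weight q > 0" for q y B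
  proof -
    have "\<forall>q. q \<in># transmit y B \<longrightarrow> weight q > 0"
      using that(2) by (auto simp: transmit_def split: option.split dest!: in_diffD)
    then show ?thesis using that(1) by (auto simp: age_def)
  qed
  ultimately show ?case using step.IH by (auto simp: next_state_def Let_def)
qed

abbreviation state_excess :: "state \<Rightarrow> real" where
  "state_excess s \<equiv> excess (alg_buf s) (adv_buf s)"

text \<open>After the two transmissions, neither aging nor the common injection raises the
  cost.\<close>

lemma state_excess_next_le:
  assumes "legal_adversary A" "possible_state A (next_state A s x)"
    and "matched (transmit x (alg_buf s)) (transmit (answer A (history s)) (adv_buf s)) y"
  shows "state_excess (next_state A s x) \<le> y"
proof -
  have "\<forall>q. q \<in># inject A (history (next_state A s x)) \<longrightarrow> weight q > 0"
    using assms(1,2) unfolding legal_adversary_def by blast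
  then have "\<And>q. q \<in># inject A (history s @ [x]) \<Longrightarrow> 0 \<le> weight q"
    by (auto simp: next_state_def Let_def intro: less_imp_le)
  from matched_add_same[OF matched_age[OF assms(3)] this] show ?thesis
    by (intro excess_le) (simp add: next_state_def Let_def)
qed

text \<open>The link is the weight w_1 of h_1 when MIX-R has a packet: the gain of ADV plus the
  expected new potential exceeds the old potential by at most w_1, and \<open>c\<close> times w_1 is
  at most the expected gain of MIX-R. Potentials stand on both sides, which avoids the truncated
  subtraction of \<open>ennreal\<close>.\<close>

lemma excess_step:
  assumes legal: "legal_adversary A" and s: "possible_state A s"
    and N: "1 \<le> N" "\<And>n. n \<in> support_sizes A \<Longrightarrow> n \<le> N"
  defines "c \<equiv> 1 - (1 - 1 / real N) ^ N"
  shows "ennreal c * (move_weight (answer A (history s)) +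
      (\<integral>\<^sup>+k. ennreal (state_excess (next_state A s (mixr_packet (alg_buf s) k))) \<partial>mixr_index (alg_buf s)))
    \<le> (\<integral>\<^sup>+k. move_weight (mixr_packet (alg_buf s) k) \<partial>mixr_index (alg_buf s)) +
      ennreal c * ennreal (state_excess s)"
proof -
  define a where "a = alg_buf s"
  define b where "b = adv_buf s"
  define z where "z = answer A (history s)"
  define E where "E k = state_excess (next_state A s (mixr_packet a k))" for k
  have c: "0 \<le> c" using N(1) by (simp add: c_def power_le_one)
  have pos: "\<And>q. q \<in># a \<Longrightarrow> weight q > 0" and posb: "\<And>q. q \<in># b \<Longrightarrow> weight q > 0"
    using possible_state_weight_pos[OF legal s] by (auto simp: a_def b_def)
  have nnb: "\<And>q. q \<in># b \<Longrightarrow> 0 \<le> weight q" using posb by (simp add: less_imp_le)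
  have z: "\<And>q. z = Some q \<Longrightarrow> q \<in># b"
    using legal s unfolding legal_adversary_def z_def b_def by blast
  have z0: "0 \<le> move_value z" using z nnb by (auto simp: move_value_def split: option.split)
  have possible: "possible_state A (next_state A s (mixr_packet a k))" if "k \<in> set_pmf (mixr_index a)" for k
    using that by (intro possible_state.step[OF s]) (simp add: mixr_def a_def)
  have E0: "0 \<le> E k" if "k \<in> set_pmf (mixr_index a)" for k
    using possible_state_weight_pos[OF legal possible[OF that]] unfolding E_def
    by (intro excess_nonneg less_imp_le) auto
  have E_le: "E k \<le> y" if "k \<in> set_pmf (mixr_index a)"
    "matched (transmit (mixr_packet a k) a) (transmit z b) y" for k y
    using state_excess_next_le[OF legal possible[OF that(1)]] that(2)
    unfolding E_def a_def b_def z_def by blast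
  have "ennreal c * (ennreal (move_value z) + (\<integral>\<^sup>+k. ennreal (E k) \<partial>mixr_index a))
    \<le> (\<integral>\<^sup>+k. ennreal (move_value (mixr_packet a k)) \<partial>mixr_index a) + ennreal c * ennreal (excess a b)"
  proof (cases "a = {#}")
    case True
    then have idx: "mixr_index a = return_pmf 0" by (simp add: mixr_index_def)
    \<comment> \<open>With no packets on the side of MIX-R everything is unmatched, so the
      transmission of ADV lowers the cost by its full weight.\<close>
    have "move_value z + E 0 \<le> excess a b"
    proof (rule le_excess[OF nnb])
      fix x assume m: "matched a b x"
      have "matched a (transmit z b) (x - move_value z)"
      proof (cases z)
        case (Some q)
        then show ?thesis using matched_remove_right[OF m z[OF Some]] True
          by (simp add: transmit_def move_value_def)
      qed (use m in \<open>simp add: transmit_def move_value_def\<close>)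
      then have "E 0 \<le> x - move_value z"
        by (intro E_le) (simp_all add: idx mixr_packet_def transmit_def)
      then show "move_value z + E 0 \<le> x" by simp
    qed
    then show ?thesis using c z0 E0[of 0]
      by (simp add: idx mixr_packet_def move_value_def mult_left_mono flip: ennreal_plus ennreal_mult')
  next
    case False
    define P where "P = set_mset a"
    let ?K = "{1..mixr_n P}" and ?w = "\<lambda>k. weight (mixr_h P k)"
    have P: "finite P" "P \<noteq> {}" "\<And>q. q \<in> P \<Longrightarrow> weight q > 0" using False pos by (auto simp: P_def)
    have pmf: "pmf (mixr_index a) k = (if k \<in> ?K then mixr_p P k else 0)" for k
      using pmf_mixr_index[OF False pos] by (simp add: P_def)
    have supp: "set_pmf (mixr_index a) = ?K"
      using mixr_p_pos[OF P] by (force simp: set_pmf_eq pmf)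
    have p0: "0 \<le> mixr_p P k" if "k \<in> ?K" for k using mixr_p_pos[OF P that] by simp
    have integral: "(\<integral>\<^sup>+k. ennreal (f k) \<partial>mixr_index a) = ennreal (\<Sum>k\<in>?K. mixr_p P k * f k)"
      if "\<And>k. k \<in> ?K \<Longrightarrow> 0 \<le> f k" for f
    proof -
      have "(\<integral>\<^sup>+k. ennreal (f k) \<partial>mixr_index a) = (\<Sum>k\<in>?K. ennreal (f k) * pmf (mixr_index a) k)"
        by (rule nn_integral_measure_pmf_support) (auto simp: supp)
      also have "\<dots> = (\<Sum>k\<in>?K. ennreal (mixr_p P k * f k))"
        using that p0 by (intro sum.cong) (auto simp: pmf ennreal_mult mult.commute)
      also have "\<dots> = ennreal (\<Sum>k\<in>?K. mixr_p P k * f k)"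
        using that p0 by (intro sum_ennreal) auto
      finally show ?thesis .
    qed
    have packet: "mixr_packet a k = Some (mixr_h P k)" if "k \<in> ?K" for k
      using that by (simp add: mixr_packet_def P_def)
    have w0: "0 \<le> ?w k" if "k \<in> ?K" for k
      using weight_mixr_h_pos[OF P, of k] mixr_n_le_last[OF P] that by auto
    \<comment> \<open>The charge \<open>g\<close> depends on the matching, but the bound on its
      expectation does not. The estimate therefore holds for every \<open>x\<close> and passes to
      the infimum.\<close>
    have "move_value z + (\<Sum>k\<in>?K. mixr_p P k * E k) - ?w 1 \<le> excess a b"
    proof (rule le_excess[OF nnb])
      fix x assume m: "matched a b x"
      obtain g where g: "\<And>k. k \<in> ?K \<Longrightarrow>
          matched (a - {#mixr_h P k#}) (transmit z b) (x - move_value z + g k)"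
        "(\<Sum>k\<in>?K. mixr_p P k * g k) \<le> ?w 1"
        using matched_step[OF False pos z m] unfolding P_def by blast
      have "(\<Sum>k\<in>?K. mixr_p P k * E k) \<le> (\<Sum>k\<in>?K. mixr_p P k * (x - move_value z + g k))"
        using g(1) p0 packet
        by (intro sum_mono mult_left_mono E_le) (auto simp: supp transmit_def)
      also have "\<dots> = (x - move_value z) + (\<Sum>k\<in>?K. mixr_p P k * g k)"
        using sum_mixr_p[OF P] by (simp add: distrib_left sum.distrib flip: sum_distrib_right)
      finally show "move_value z + (\<Sum>k\<in>?K. mixr_p P k * E k) - ?w 1 \<le> x"
        using g(2) by linarith
    qed
    then have "c * (move_value z + (\<Sum>k\<in>?K. mixr_p P k * E k)) \<le> c * (excess a b + ?w 1)"
      using c by (intro mult_left_mono) auto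
    also have "\<dots> \<le> (\<Sum>k\<in>?K. mixr_p P k * ?w k) + c * excess a b"
    proof -
      \<comment> \<open>Here the bound \<open>N\<close> over all possible states is applied to the
        present one.\<close>
      have "mixr_support_size a \<in> support_sizes A"
        using s by (auto simp: support_sizes_def a_def)
      then have "mixr_n P \<le> N"
        using N(2) mixr_support_size_eq[OF False pos] by (simp add: P_def)
      from sum_mixr_p_weight_ge[OF P N(1) this] show ?thesis
        by (simp add: c_def algebra_simps)
    qed
    finally have main: "c * (move_value z + (\<Sum>k\<in>?K. mixr_p P k * E k)) \<le>
      (\<Sum>k\<in>?K. mixr_p P k * ?w k) + c * excess a b" .
    have "(\<integral>\<^sup>+k. ennreal (move_value (mixr_packet a k)) \<partial>mixr_index a) =
        ennreal (\<Sum>k\<in>?K. mixr_p P k * move_value (mixr_packet a k))"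
      using w0 by (intro integral) (simp add: packet move_value_def)
    also have "\<dots> = ennreal (\<Sum>k\<in>?K. mixr_p P k * ?w k)"
      by (intro arg_cong[of _ _ ennreal] sum.cong) (simp_all add: packet move_value_def)
    finally have alg: "(\<integral>\<^sup>+k. ennreal (move_value (mixr_packet a k)) \<partial>mixr_index a) =
        ennreal (\<Sum>k\<in>?K. mixr_p P k * ?w k)" .
    have adv: "(\<integral>\<^sup>+k. ennreal (E k) \<partial>mixr_index a) = ennreal (\<Sum>k\<in>?K. mixr_p P k * E k)"
      using E0 by (intro integral) (simp add: supp)
    have "0 \<le> (\<Sum>k\<in>?K. mixr_p P k * E k)" "0 \<le> (\<Sum>k\<in>?K. mixr_p P k * ?w k)" "0 \<le> excess a b"
      using E0 p0 w0 excess_nonneg[OF nnb] by (auto intro!: sum_nonneg simp: supp)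
    then show ?thesis
      unfolding alg adv using main c z0
      by (simp flip: ennreal_plus ennreal_mult add: ennreal_leI)
  qed
  then show ?thesis by (simp add: move_weight_eq E_def a_def b_def z_def)
qed


section \<open>Expectations over plays\<close>

text \<open>The law of the first \<open>t\<close> indices. The constant \<open>undefined\<close> is
  the empty prefix, as an extensional function on the empty set.\<close>

abbreviation prefix_measure :: "adversary \<Rightarrow> nat \<Rightarrow> (nat \<Rightarrow> nat) measure" where
  "prefix_measure A t \<equiv> play.C A 0 t (\<lambda>_. undefined)"

text \<open>Prefixes form a discrete space, so every function of a prefix is measurable.\<close>

lemma PiM_prefix:
  "PiM {0..<t::nat} (\<lambda>_. count_space (UNIV :: nat set)) = count_space ({0..<t} \<rightarrow>\<^sub>E UNIV)"
  by (rule count_space_PiM_finite) simp_all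

lemma run_cong: "(\<And>i. i < t \<Longrightarrow> \<omega> i = \<omega>' i) \<Longrightarrow> run A \<omega> t = run A \<omega>' t"
proof (induction t)
  case (Suc t)
  then have "run A \<omega> t = run A \<omega>' t" "\<omega> t = \<omega>' t" by auto
  then show ?case by simp
qed simp

lemma undefined_in_space: "(\<lambda>_. undefined) \<in> space (PiM {0..<0::nat} (\<lambda>_. count_space (UNIV :: nat set)))"
  by (simp add: space_PiM)

text \<open>Conditioning on the first \<open>t\<close> indices: the last kernel of the composition
  is integrated first.\<close>

lemma nn_integral_prefix_Suc:
  "(\<integral>\<^sup>+\<omega>. f \<omega> \<partial>prefix_measure A (Suc t))
     = (\<integral>\<^sup>+\<omega>. \<integral>\<^sup>+k. f (fun_upd \<omega> t k) \<partial>mixr_index (alg_buf (run A \<omega> t)) \<partial>prefix_measure A t)"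
proof -
  have f: "f \<in> borel_measurable (PiM {0..<Suc t} (\<lambda>_. count_space UNIV))"
    unfolding PiM_prefix by simp
  have "(\<integral>\<^sup>+\<omega>. f \<omega> \<partial>prefix_measure A (Suc t)) =
      (\<integral>\<^sup>+\<omega>. \<integral>\<^sup>+\<omega>'. f \<omega>' \<partial>play.eP A t \<omega> \<partial>prefix_measure A t)"
    using nn_integral_bind[OF f, of "play.eP A t" "prefix_measure A t"] play.measurable_eP[of A t]
    by (simp add: measurable_cong_sets[OF play.sets_C[OF undefined_in_space] refl])
  also have "\<dots> = (\<integral>\<^sup>+\<omega>. \<integral>\<^sup>+k. f (fun_upd \<omega> t k) \<partial>mixr_index (alg_buf (run A \<omega> t)) \<partial>prefix_measure A t)"
    by (intro nn_integral_cong, subst play.nn_integral_eP[OF _ f])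
      (simp_all add: play.space_C[OF undefined_in_space] play_kernel_def)
  finally show ?thesis .
qed

section \<open>Finite marginals of the law of plays\<close>

lemma measurable_restrict_play:
  "(\<lambda>\<omega>. restrict \<omega> {0..<t})
     \<in> measurable (play_measure A) (PiM {0..<t} (\<lambda>_. count_space UNIV))"
  unfolding play_measure_def
  by (subst measurable_cong_sets[OF play.PF.sets_lim refl]) (rule measurable_restrict_subset, simp)

lemma borel_measurable_play:
  fixes f :: "(nat \<Rightarrow> nat) \<Rightarrow> ennreal"
  assumes f: "\<And>\<omega>. f (restrict \<omega> {0..<t}) = f \<omega>"
  shows "f \<in> borel_measurable (play_measure A)"
proof -
  have "f \<in> borel_measurable (PiM {0..<t} (\<lambda>_. count_space UNIV))"
    unfolding PiM_prefix by simp
  from measurable_comp[OF measurable_restrict_play this] show ?thesis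
    by (simp add: comp_def f)
qed

lemma borel_measurable_prefix: "(f :: _ \<Rightarrow> ennreal) \<in> borel_measurable (prefix_measure A t)"
  by (subst measurable_cong_sets[OF play.sets_C[OF undefined_in_space] refl]) (simp add: PiM_prefix)

text \<open>The least bound of the index set is \<open>t\<close> itself, so the projection that
  defines \<open>play.CI\<close> forgets no coordinate.\<close>

lemma CI_prefix: "play.CI A {0..<t} = prefix_measure A t"
proof -
  have "play.up_to {0..<t} = t"
  proof (rule antisym)
    show "play.up_to {0..<t} \<le> t" by (subst play.up_to_iff) auto
    show "t \<le> play.up_to {0..<t}"
      using play.up_to_less[of "{0..<t}" "t - 1"] by (cases "t = 0") auto
  qed
  then show ?thesis
    using play.distr_C[OF order_refl undefined_in_space, of A t] by (simp add: play.CI_def)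
qed

lemma nn_integral_play_prefix:
  assumes f: "\<And>\<omega>. f (restrict \<omega> {0..<t}) = f \<omega>"
  shows "(\<integral>\<^sup>+\<omega>. f \<omega> \<partial>play_measure A) = (\<integral>\<^sup>+\<omega>. f \<omega> \<partial>prefix_measure A t)"
proof -
  let ?M = "\<lambda>_::nat. count_space (UNIV :: nat set)"
  let ?J = "{0..<t}"
  have meas: "f \<in> borel_measurable (PiM ?J ?M)" unfolding PiM_prefix by simp
  have "(\<integral>\<^sup>+\<omega>. f \<omega> \<partial>play_measure A) = (\<integral>\<^sup>+\<omega>. f (restrict \<omega> ?J) \<partial>play_measure A)"
    by (simp add: f)
  also have "\<dots> = (\<integral>\<^sup>+\<omega>. f \<omega> \<partial>distr (play_measure A) (PiM ?J ?M) (\<lambda>\<omega>. restrict \<omega> ?J))"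
    by (rule nn_integral_distr[OF measurable_restrict_play, symmetric]) (simp add: meas)
  also have "\<dots> = (\<integral>\<^sup>+\<omega>. f \<omega> \<partial>prefix_measure A t)"
    unfolding play_measure_def by (subst play.distr_lim) (auto simp: CI_prefix)
  finally show ?thesis .
qed

lemma run_fun_upd:
  "run A (fun_upd \<omega> t k) t = run A \<omega> t"
  "run A (fun_upd \<omega> t k) (Suc t) =
     next_state A (run A \<omega> t) (mixr_packet (alg_buf (run A \<omega> t)) k)"
proof -
  show *: "run A (fun_upd \<omega> t k) t = run A \<omega> t" by (rule run_cong) simp
  show "run A (fun_upd \<omega> t k) (Suc t) =
     next_state A (run A \<omega> t) (mixr_packet (alg_buf (run A \<omega> t)) k)"
    by (simp add: *)
qed

text \<open>An arbitrary index sequence may contain draws of probability 0 and leave the possible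
  states, whereas \<open>excess_step\<close> requires a possible state. Integrating the indicator of
  the bad prefixes makes the one-step formula applicable.\<close>

lemma AE_possible_run: "AE \<omega> in prefix_measure A t. possible_state A (run A \<omega> t)"
proof (induction t)
  case 0
  show ?case by (simp add: possible_state.init)
next
  case (Suc t)
  let ?bad = "\<lambda>\<omega>. indicator {\<omega>. \<not> possible_state A (run A \<omega> (Suc t))} \<omega> :: ennreal"
  have inner: "(\<integral>\<^sup>+k. ?bad (fun_upd \<omega> t k) \<partial>mixr_index (alg_buf (run A \<omega> t))) = 0"
    if "possible_state A (run A \<omega> t)" for \<omega>
  proof (subst nn_integral_0_iff_AE, simp, intro AE_pmfI)
    fix k assume "k \<in> set_pmf (mixr_index (alg_buf (run A \<omega> t)))"
    then have "mixr_packet (alg_buf (run A \<omega> t)) k \<in> set_pmf (mixr (alg_buf (run A \<omega> t)))"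
      by (simp add: mixr_def)
    from possible_state.step[OF that this] show "?bad (fun_upd \<omega> t k) = 0"
      by (simp add: run_fun_upd(2) del: run.simps)
  qed
  have "(\<integral>\<^sup>+\<omega>. ?bad \<omega> \<partial>prefix_measure A (Suc t)) = (\<integral>\<^sup>+\<omega>. 0 \<partial>prefix_measure A t)"
    unfolding nn_integral_prefix_Suc
    by (rule nn_integral_cong_AE) (use Suc in eventually_elim, rule inner)
  then have "AE \<omega> in prefix_measure A (Suc t). ?bad \<omega> = 0"
    using nn_integral_0_iff_AE[OF borel_measurable_prefix[where f = ?bad and A = A and t = "Suc t"]] by simp
  then show ?case by eventually_elim (simp add: indicator_def split: if_splits)
qed

text \<open>The integrated step inequality is summed over the first \<open>T\<close> steps. The
  potential starts at 0 and is finally discarded as nonnegative, and then \<open>T\<close> tends to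
  infinity.\<close>

theorem theorem4:
  fixes A :: adversary and N :: nat
  assumes "legal_adversary A"
    and "N \<ge> 1"
    and "N \<in> support_sizes A"
    and "\<And>n. n \<in> support_sizes A \<Longrightarrow> n \<le> N"
  shows "(\<integral>\<^sup>+\<omega>. alg_gain A \<omega> \<partial>play_measure A)
       \<ge> ennreal (1 - (1 - 1 / real N) ^ N) * (\<integral>\<^sup>+\<omega>. adv_gain A \<omega> \<partial>play_measure A)"
proof -
  let ?c = "ennreal (1 - (1 - 1 / real N) ^ N)" and ?M = "play_measure A"
  define alg where "alg t \<omega> = move_weight (mixr_packet (alg_buf (run A \<omega> t)) (\<omega> t))" for t \<omega>
  define adv where "adv t \<omega> = move_weight (answer A (history (run A \<omega> t)))" for t \<omega>
  define ex where "ex t \<omega> = ennreal (state_excess (run A \<omega> t))" for t \<omega>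
  have run_restrict: "run A (restrict \<omega> {0..<n}) t = run A \<omega> t" if "t \<le> n" for \<omega> t n
    using that by (intro run_cong) auto
  \<comment> \<open>The move of MIX-R in step \<open>t\<close> reads index \<open>t\<close> and
    needs a prefix of length \<open>Suc t\<close>. The answer of ADV is fixed by the first
    \<open>t\<close> indices.\<close>
  have alg_restrict: "alg t (restrict \<omega> {0..<Suc t}) = alg t \<omega>" for t \<omega>
    by (simp add: alg_def run_restrict)
  have adv_restrict: "adv t (restrict \<omega> {0..<t}) = adv t \<omega>" for t \<omega>
    by (simp add: adv_def run_restrict)
  have step: "?c * ((\<integral>\<^sup>+\<omega>. adv t \<omega> \<partial>?M) + (\<integral>\<^sup>+\<omega>. ex (Suc t) \<omega> \<partial>prefix_measure A (Suc t)))
    \<le> (\<integral>\<^sup>+\<omega>. alg t \<omega> \<partial>?M) + ?c * (\<integral>\<^sup>+\<omega>. ex t \<omega> \<partial>prefix_measure A t)" for t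
  proof -
    let ?Q = "\<lambda>\<omega>. measure_pmf (mixr_index (alg_buf (run A \<omega> t)))"
    have "?c * ((\<integral>\<^sup>+\<omega>. adv t \<omega> \<partial>?M) + (\<integral>\<^sup>+\<omega>. ex (Suc t) \<omega> \<partial>prefix_measure A (Suc t)))
      = (\<integral>\<^sup>+\<omega>. ?c * (adv t \<omega> + (\<integral>\<^sup>+k. ex (Suc t) (fun_upd \<omega> t k) \<partial>?Q \<omega>)) \<partial>prefix_measure A t)"
      by (simp add: nn_integral_play_prefix[where f = "adv t", OF adv_restrict] nn_integral_prefix_Suc
          nn_integral_cmult nn_integral_add borel_measurable_prefix del: play.C.simps)
    also have "\<dots> \<le> (\<integral>\<^sup>+\<omega>. (\<integral>\<^sup>+k. alg t (fun_upd \<omega> t k) \<partial>?Q \<omega>) + ?c * ex t \<omega> \<partial>prefix_measure A t)"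
    proof (rule nn_integral_mono_AE)
      show "AE \<omega> in prefix_measure A t. ?c * (adv t \<omega> + (\<integral>\<^sup>+k. ex (Suc t) (fun_upd \<omega> t k) \<partial>?Q \<omega>))
        \<le> (\<integral>\<^sup>+k. alg t (fun_upd \<omega> t k) \<partial>?Q \<omega>) + ?c * ex t \<omega>"
        using AE_possible_run[of A t]
      proof eventually_elim
        case (elim \<omega>)
        from excess_step[OF assms(1) elim assms(2,4)] show ?case
          by (simp add: adv_def alg_def ex_def run_fun_upd del: run.simps)
      qed
    qed
    also have "\<dots> = (\<integral>\<^sup>+\<omega>. alg t \<omega> \<partial>?M) + ?c * (\<integral>\<^sup>+\<omega>. ex t \<omega> \<partial>prefix_measure A t)"
      by (simp add: nn_integral_play_prefix[where f = "alg t", OF alg_restrict] nn_integral_prefix_Suc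
          nn_integral_cmult nn_integral_add borel_measurable_prefix del: play.C.simps)
    finally show ?thesis .
  qed
  have partial: "?c * ((\<Sum>t<T. \<integral>\<^sup>+\<omega>. adv t \<omega> \<partial>?M) + (\<integral>\<^sup>+\<omega>. ex T \<omega> \<partial>prefix_measure A T))
    \<le> (\<Sum>t<T. \<integral>\<^sup>+\<omega>. alg t \<omega> \<partial>?M)" for T
  proof (induction T)
    case 0
    \<comment> \<open>Both buffers start with the same first injection.\<close>
    have "ex 0 \<omega> = 0" for \<omega>
    proof -
      have "\<forall>q. q \<in># adv_buf (init_state A) \<longrightarrow> weight q > 0"
        using possible_state_weight_pos[OF assms(1) possible_state.init] by blast
      then have "excess (adv_buf (init_state A)) (adv_buf (init_state A)) = 0"
        by (intro excess_same) (blast intro: less_imp_le)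
      then show ?thesis by (simp add: ex_def init_state_def)
    qed
    then show ?case by simp
  next
    case (Suc T)
    let ?S = "\<lambda>f. \<Sum>t<T. \<integral>\<^sup>+\<omega>. f t \<omega> \<partial>?M"
    have "?c * ((\<Sum>t<Suc T. \<integral>\<^sup>+\<omega>. adv t \<omega> \<partial>?M) + (\<integral>\<^sup>+\<omega>. ex (Suc T) \<omega> \<partial>prefix_measure A (Suc T)))
      = ?c * ?S adv + ?c * ((\<integral>\<^sup>+\<omega>. adv T \<omega> \<partial>?M) + (\<integral>\<^sup>+\<omega>. ex (Suc T) \<omega> \<partial>prefix_measure A (Suc T)))"
      by (simp add: distrib_left add.assoc del: play.C.simps)
    also have "\<dots> \<le> ?c * ?S adv + ((\<integral>\<^sup>+\<omega>. alg T \<omega> \<partial>?M) + ?c * (\<integral>\<^sup>+\<omega>. ex T \<omega> \<partial>prefix_measure A T))"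
      by (intro add_left_mono step)
    \<comment> \<open>The terms are regrouped so that the old potential joins the sum bounded by the
      induction hypothesis.\<close>
    also have "\<dots> = ?c * (?S adv + (\<integral>\<^sup>+\<omega>. ex T \<omega> \<partial>prefix_measure A T)) + (\<integral>\<^sup>+\<omega>. alg T \<omega> \<partial>?M)"
      by (simp add: distrib_left ac_simps)
    also have "\<dots> \<le> ?S alg + (\<integral>\<^sup>+\<omega>. alg T \<omega> \<partial>?M)"
      by (intro add_right_mono Suc.IH)
    finally show ?case by simp
  qed
  have "?c * (\<integral>\<^sup>+\<omega>. adv_gain A \<omega> \<partial>?M) = ?c * (\<Sum>t. \<integral>\<^sup>+\<omega>. adv t \<omega> \<partial>?M)"
    unfolding adv_gain_def adv_def[symmetric]
    by (subst nn_integral_suminf) (rule borel_measurable_play, rule adv_restrict, simp)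
  \<comment> \<open>Expected gains may be infinite, so the comparison is made for each finite
    horizon \<open>T\<close>.\<close>
  also have "\<dots> = (SUP T. ?c * (\<Sum>t<T. \<integral>\<^sup>+\<omega>. adv t \<omega> \<partial>?M))"
    by (simp add: suminf_eq_SUP SUP_mult_left_ennreal)
  also have "\<dots> \<le> (\<Sum>t. \<integral>\<^sup>+\<omega>. alg t \<omega> \<partial>?M)"
  proof (rule SUP_least)
    fix T
    have "?c * (\<Sum>t<T. \<integral>\<^sup>+\<omega>. adv t \<omega> \<partial>?M)
      \<le> ?c * ((\<Sum>t<T. \<integral>\<^sup>+\<omega>. adv t \<omega> \<partial>?M) + (\<integral>\<^sup>+\<omega>. ex T \<omega> \<partial>prefix_measure A T))"
      by (intro mult_left_mono) auto
    also have "\<dots> \<le> (\<Sum>t. \<integral>\<^sup>+\<omega>. alg t \<omega> \<partial>?M)"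
      by (rule order.trans[OF partial sum_le_suminf]) auto
    finally show "?c * (\<Sum>t<T. \<integral>\<^sup>+\<omega>. adv t \<omega> \<partial>?M) \<le> (\<Sum>t. \<integral>\<^sup>+\<omega>. alg t \<omega> \<partial>?M)" .
  qed
  also have "\<dots> = (\<integral>\<^sup>+\<omega>. alg_gain A \<omega> \<partial>?M)"
    unfolding alg_gain_def alg_def[symmetric]
    by (subst nn_integral_suminf) (rule borel_measurable_play, rule alg_restrict, simp)
  finally show ?thesis .
qed

end
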